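(* Let $0<\alpha<\pi/2$. Let $\Lambda\subseteq\mathbb Z$ be such that $\Lambda\cap 2\mathbb Z=\{p_k\}_{k\in\mathbb Z}$ and $\Lambda\cap(2\mathbb Z+1)=\{q_k\}_{k\in\mathbb Z}$, where $(p_k)_{k\in\mathbb Z}$ and $(q_k)_{k\in\mathbb Z}$ are strictly increasing bi-infinite sequences, and set $$\delta_e=\sup_{k}(p_{k+1}-p_k),\qquad \delta_o=\sup_{k}(q_{k+1}-q_k).$$ If $\max(\delta_e,\delta_o)<\pi/\alpha$, then $\Lambda$ is a sampling sequence for $PW_\alpha$; namely, there exists $c>0$ such that, for every $F\in PW_\alpha$, $$c\,\|F\|^2_{PW_\alpha}\leqslant \sum_{\lambda\in\Lambda}|F(\lambda,0)|^2\leqslant \|F\|^2_{PW_\alpha}.$$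
   Context: A function $F:\mathbb Z^2\to\mathbb C$ is (discrete) entire if $F(m+1,n+1)-F(m,n)=-i\big(F(m,n+1)-F(m+1,n)\big)$ for every $(m,n)\in\mathbb Z^2$. For $t\in[-\pi,\pi)$, $t\neq\pm\pi/2$, the discrete exponential is $e_t:\mathbb Z^2\to\mathbb C$, $e_t(m,n)=e^{itm}\Big(\frac{1+ie^{it}}{i+e^{it}}\Big)^n$. The space $PW_\alpha$ is the set of all entire $F:\mathbb Z^2\to\mathbb C$ such that (i) there exists $c>0$ with $|F(m,n)|\leqslant c\,|e_{-\alpha}(0,1)|^{|n|}$ for every $(m,n)\in\mathbb Z^2$, and (ii) $\sum_{m\in\mathbb Z}|F(m,0)|^2<+\infty$; it is endowed with $\|F\|_{PW_\alpha}^2=\sum_{m\in\mathbb Z}|F(m,0)|^2$. *)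

theory Defs
  imports "HOL-Analysis.Analysis"
begin

definition discrete_entire :: "(int \<times> int \<Rightarrow> complex) \<Rightarrow> bool" where
  "discrete_entire F \<longleftrightarrow>
     (\<forall>m n. F (m + 1, n + 1) - F (m, n) = - \<i> * (F (m, n + 1) - F (m + 1, n)))"

text \<open>The mathematical domain of the parameter is \<open>t \<in> [-\<pi>, \<pi>)\<close>, \<open>t \<noteq> \<plusminus>\<pi>/2\<close>; outside it the values
  carry no meaning (at \<open>t = -\<pi>/2\<close> the denominator vanishes).\<close>

definition discrete_exp :: "real \<Rightarrow> int \<times> int \<Rightarrow> complex" where
  "discrete_exp t = (\<lambda>(m, n).
     exp (\<i> * of_real t * of_int m) *
     ((1 + \<i> * exp (\<i> * of_real t)) / (\<i> + exp (\<i> * of_real t))) powi n)"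

definition PW :: "real \<Rightarrow> (int \<times> int \<Rightarrow> complex) set" where
  "PW \<alpha> = {F. discrete_entire F \<and>
     (\<exists>c>0. \<forall>m n. norm (F (m, n)) \<le> c * norm (discrete_exp (- \<alpha>) (0, 1)) ^ nat \<bar>n\<bar>) \<and>
     (\<lambda>m. (norm (F (m, 0)))\<^sup>2) summable_on UNIV}"

definition PW_norm :: "(int \<times> int \<Rightarrow> complex) \<Rightarrow> real" where
  "PW_norm F = sqrt (\<Sum>\<^sub>\<infinity>m. (norm (F (m, 0)))\<^sup>2)"

text \<open>The supremum is taken in the extended reals, so that it is \<open>\<infinity>\<close> for unbounded gaps.\<close>

definition sup_gap :: "(int \<Rightarrow> int) \<Rightarrow> ereal" where
  "sup_gap p = (SUP k. ereal (of_int (p (k + 1) - p k)))"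

end

theory Submission
  imports Defs
begin

text \<open>
  Let \<open>f m = F (m, 0)\<close>. On the Fourier side, passing from one row of a discrete entire function to
  the next is multiplication by \<open>cos t / (1 + sin t)\<close>, so the growth condition in \<open>PW \<alpha>\<close> should force
  the spectrum of \<open>f\<close> into \<open>\<bar>sin t\<bar> \<le> sin \<alpha>\<close>. What is needed of this Paley--Wiener statement is only
  the Bernstein inequality
  \[ \sum_m |f(m+2) - f(m)|^2 \le 4 \sin^2\alpha \sum_m |f(m)|^2 , \]
  proved in \<open>PW_double_difference\<close> without Fourier analysis. Discrete entire functions are
  diagonally harmonic: the mean \<open>H\<close> over the two horizontal neighbours inverts the mean \<open>V\<close>
  over the two vertical ones. Hence the rows \<open>n = 0\<close> of the \<open>k\<close>-fold vertical means of \<open>F\<close> are iterated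
  preimages of \<open>f\<close> under \<open>H\<close>, and the growth condition bounds them by a multiple of \<open>(1 / cos \<alpha>)\<^sup>k\<close>.
  Since \<open>H\<close> is self-adjoint, the norms of iterated preimages form a log-convex sequence, so such a
  bound already controls the first step: \<open>cos \<alpha> \<cdot> \<parallel>f\<parallel> \<le> \<parallel>H f\<parallel>\<close>. The preimages are merely bounded, and
  this argument is therefore run in \<open>\<ell>\<^sup>2\<close> with the weight \<open>r ^ \<bar>m\<bar>\<close>, letting \<open>r\<close> tend to \<open>1\<close>
  (\<open>bounded_preimages_energy\<close>). The parallelogram law turns it into the Bernstein inequality.

  In the other direction, choose \<open>\<beta> > \<alpha>\<close> such that all gaps of the sampling set within one parity
  class are still shorter than \<open>\<pi> / \<beta>\<close>. On a gap with midpoint \<open>c\<close> the function \<open>cos (\<beta> (m - c))\<close> is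
  positive and is an eigenfunction of the negative second difference of step \<open>2\<close>, with eigenvalue
  \<open>4 sin\<^sup>2 \<beta>\<close>. Comparison with it (a discrete Picone identity) gives, for some constant \<open>C\<close>,
  \[ 4 \sin^2\beta \sum_m |f(m)|^2 \le \sum_m |f(m+2) - f(m)|^2 + C \sum_{\lambda\in\Lambda} |f(\lambda)|^2 , \]
  which is \<open>cosine_barrier_energy\<close>. Subtracting the Bernstein inequality leaves the lower sampling
  bound with constant \<open>4 (sin\<^sup>2 \<beta> - sin\<^sup>2 \<alpha>) / C\<close>. The upper bound is trivial.
\<close>

section \<open>Sums over the integers\<close>

lemma summable_on_shift_int:
  fixes \<phi> :: "int \<Rightarrow> real"
  shows "(\<lambda>m. \<phi> (m + k)) summable_on UNIV \<longleftrightarrow> \<phi> summable_on UNIV"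
proof (rule summable_on_reindex_bij_betw)
  show "bij_betw (\<lambda>m. m + k) UNIV UNIV"
    by (rule bij_betwI[where g = "\<lambda>m. m - k"]) auto
qed

lemma infsum_shift_int:
  fixes \<phi> :: "int \<Rightarrow> real"
  shows "(\<Sum>\<^sub>\<infinity>m. \<phi> (m + k)) = (\<Sum>\<^sub>\<infinity>m. \<phi> m)"
proof (rule infsum_reindex_bij_betw)
  show "bij_betw (\<lambda>m. m + k) UNIV UNIV"
    by (rule bij_betwI[where g = "\<lambda>m. m - k"]) auto
qed

lemma geometric_weight_int:
  fixes r :: real
  assumes "0 < r" "r < 1"
  shows "(\<lambda>m::int. r ^ nat \<bar>m\<bar>) summable_on UNIV"
    and "(\<Sum>\<^sub>\<infinity>m::int. r ^ nat \<bar>m\<bar>) \<le> 2 / (1 - r)"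
proof -
  have fin: "(\<Sum>m\<in>S. r ^ nat \<bar>m\<bar>) \<le> 2 / (1 - r)" if fS: "finite S" for S :: "int set"
  proof -
    obtain N where N: "\<And>m. m \<in> S \<Longrightarrow> nat \<bar>m\<bar> < N"
    proof -
      have "finite ((\<lambda>m. nat \<bar>m\<bar>) ` S)" using fS by simp
      then obtain N where "\<forall>x\<in>(\<lambda>m. nat \<bar>m\<bar>) ` S. x < N"
        using finite_nat_set_iff_bounded by blast
      then show ?thesis using that by blast
    qed
    have sub: "S \<subseteq> int ` {..<N} \<union> (\<lambda>n. - int n) ` {..<N}"
    proof
      fix m assume "m \<in> S"
      then have "nat \<bar>m\<bar> \<in> {..<N}" using N by simp
      moreover have "m = int (nat \<bar>m\<bar>) \<or> m = - int (nat \<bar>m\<bar>)" by auto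
      ultimately show "m \<in> int ` {..<N} \<union> (\<lambda>n. - int n) ` {..<N}" by blast
    qed
    have geo: "(\<Sum>n<N. r ^ n) \<le> 1 / (1 - r)"
    proof -
      have "(\<Sum>n<N. r ^ n) = (1 - r ^ N) / (1 - r)"
        using assms by (simp add: sum_gp_strict)
      also have "\<dots> \<le> 1 / (1 - r)"
        using assms by (intro divide_right_mono) auto
      finally show ?thesis .
    qed
    have "(\<Sum>m\<in>S. r ^ nat \<bar>m\<bar>)
        \<le> (\<Sum>m\<in>int ` {..<N} \<union> (\<lambda>n. - int n) ` {..<N}. r ^ nat \<bar>m\<bar>)"
      using assms by (intro sum_mono2 sub) auto
    also have "\<dots> \<le> (\<Sum>m\<in>int ` {..<N}. r ^ nat \<bar>m\<bar>) + (\<Sum>m\<in>(\<lambda>n. - int n) ` {..<N}. r ^ nat \<bar>m\<bar>)"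
      using assms by (subst sum.union_inter[symmetric]) (auto intro!: sum_nonneg)
    also have "\<dots> = 2 * (\<Sum>n<N. r ^ n)"
      by (simp add: sum.reindex inj_on_def)
    finally show ?thesis using geo by simp
  qed
  show summ: "(\<lambda>m::int. r ^ nat \<bar>m\<bar>) summable_on UNIV"
    using assms fin by (intro nonneg_bdd_above_summable_on bdd_aboveI2) auto
  show "(\<Sum>\<^sub>\<infinity>m::int. r ^ nat \<bar>m\<bar>) \<le> 2 / (1 - r)"
    by (rule infsum_le_finite_sums[OF summ]) (use fin in auto)
qed

text \<open>
  Neighbouring values of the weight differ by at most a factor \<open>1 + \<epsilon>\<close>. This makes the averaging
  operator self-adjoint in the weighted space up to a relative error of order \<open>\<epsilon>\<close>.
\<close>

lemma geometric_weight_ratio: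
  fixes \<epsilon> :: real and m k :: int
  assumes "\<epsilon> > 0" "\<bar>m - k\<bar> = 1"
  shows "(1 / (1 + \<epsilon>)) ^ nat \<bar>m\<bar> \<le> (1 + \<epsilon>) * (1 / (1 + \<epsilon>)) ^ nat \<bar>k\<bar>"
proof -
  have le1: "(1 / (1 + \<epsilon>)) ^ i \<le> 1" for i
    using assms by (intro power_le_one) auto
  have "nat \<bar>k\<bar> \<le> Suc (nat \<bar>m\<bar>)" using assms by linarith
  then have "(1 / (1 + \<epsilon>)) ^ Suc (nat \<bar>m\<bar>) \<le> (1 / (1 + \<epsilon>)) ^ nat \<bar>k\<bar>"
    using assms by (intro power_decreasing) auto
  moreover have "(1 / (1 + \<epsilon>)) ^ nat \<bar>m\<bar> = (1 + \<epsilon>) * (1 / (1 + \<epsilon>)) ^ Suc (nat \<bar>m\<bar>)"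
    using assms by simp
  ultimately show ?thesis using assms by (metis add_pos_pos less_imp_le mult_left_mono zero_less_one)
qed

section \<open>Bounded preimages under the averaging operator\<close>

lemma inner_weighted_young:
  fixes x y :: "'a :: real_inner" and t :: real
  assumes "0 < t"
  shows "2 * (x \<bullet> y) \<le> t * (norm y)\<^sup>2 + 1 / t * (norm x)\<^sup>2"
proof -
  have "0 \<le> (t * norm y - norm x)\<^sup>2 / t" using assms by simp
  also have "\<dots> = t * (norm y)\<^sup>2 + 1 / t * (norm x)\<^sup>2 - 2 * (norm x * norm y)"
    using assms by (simp add: field_simps power2_eq_square)
  finally show ?thesis using norm_cauchy_schwarz[of x y] by linarith
qed

lemma weighted_summable:
  fixes r K :: real and \<phi> :: "int \<Rightarrow> real"
  assumes "0 < r" "r < 1" "\<And>m. \<bar>\<phi> m\<bar> \<le> K"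
  shows "(\<lambda>m. r ^ nat \<bar>m\<bar> * \<phi> m) summable_on UNIV"
proof -
  have "(\<lambda>m::int. r ^ nat \<bar>m\<bar> * K) summable_on UNIV"
    using geometric_weight_int(1)[OF assms(1,2)] by (rule summable_on_cmult_left)
  then have "(\<lambda>m. norm (r ^ nat \<bar>m\<bar> * \<phi> m)) summable_on UNIV"
  proof (rule summable_on_comparison_test)
    fix m
    show "norm (r ^ nat \<bar>m\<bar> * \<phi> m) \<le> r ^ nat \<bar>m\<bar> * K"
      using assms by (simp add: abs_mult mult_left_mono)
  qed auto
  then show ?thesis by (rule abs_summable_summable)
qed

text \<open>
  One step of the approximate log-convexity. If \<open>H\<close> denotes the averaging operator, so that
  \<open>H g\<^sub>2 = g\<^sub>1\<close> and \<open>H g\<^sub>1 = g\<^sub>0\<close>, then \<open>\<langle>g\<^sub>1, g\<^sub>1\<rangle> = \<langle>g\<^sub>1, H g\<^sub>2\<rangle> = \<langle>g\<^sub>0, g\<^sub>2\<rangle>\<close> without a weight, and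
  Cauchy--Schwarz passes a bound for \<open>\<parallel>g\<^sub>0\<parallel> / \<parallel>g\<^sub>1\<parallel>\<close> on to \<open>\<parallel>g\<^sub>1\<parallel> / \<parallel>g\<^sub>2\<parallel>\<close>. The weight costs the
  summand \<open>4 * \<epsilon>\<close>. The weighted Young inequality with parameter \<open>\<theta>\<close> replaces Cauchy--Schwarz, so
  that all estimates are pointwise before summation.
\<close>

lemma weighted_energy_step:
  fixes g\<^sub>0 g\<^sub>1 g\<^sub>2 :: "int \<Rightarrow> complex" and \<epsilon> \<theta> K :: real
  defines "W \<equiv> \<lambda>m::int. (1 / (1 + \<epsilon>)) ^ nat \<bar>m\<bar>"
  assumes \<epsilon>: "0 < \<epsilon>" "\<epsilon> \<le> 1/4" and \<theta>: "0 < \<theta>" "\<theta> \<le> 1"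
    and bound: "\<And>m. norm (g\<^sub>0 m) \<le> K" "\<And>m. norm (g\<^sub>1 m) \<le> K" "\<And>m. norm (g\<^sub>2 m) \<le> K"
    and mean0: "\<And>m. g\<^sub>1 (m + 1) + g\<^sub>1 (m - 1) = 2 * g\<^sub>0 m"
    and mean1: "\<And>m. g\<^sub>2 (m + 1) + g\<^sub>2 (m - 1) = 2 * g\<^sub>1 m"
    and le: "(\<Sum>\<^sub>\<infinity>m. W m * (norm (g\<^sub>0 m))\<^sup>2) \<le> \<theta> * (\<Sum>\<^sub>\<infinity>m. W m * (norm (g\<^sub>1 m))\<^sup>2)"
  shows "(\<Sum>\<^sub>\<infinity>m. W m * (norm (g\<^sub>1 m))\<^sup>2) \<le> (\<theta> + 4 * \<epsilon>) * (\<Sum>\<^sub>\<infinity>m. W m * (norm (g\<^sub>2 m))\<^sup>2)"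
proof -
  define a where "a = (\<lambda>g::int \<Rightarrow> complex. \<Sum>\<^sub>\<infinity>m. W m * (norm (g m))\<^sup>2)"
  have r: "0 < 1 / (1 + \<epsilon>)" "1 / (1 + \<epsilon>) < 1" using \<epsilon> by auto
  have Wpos: "W m > 0" for m using \<epsilon> by (simp add: W_def)
  have K0: "K \<ge> 0" using bound(1)[of 0] norm_ge_zero order_trans by blast
  have inner_bd: "\<bar>x \<bullet> y\<bar> \<le> K\<^sup>2" if "norm x \<le> K" "norm y \<le> K" for x y :: complex
  proof -
    have "\<bar>x \<bullet> y\<bar> \<le> norm x * norm y" by (rule Cauchy_Schwarz_ineq2)
    also have "\<dots> \<le> K * K" using that K0 by (intro mult_mono) auto
    finally show ?thesis by (simp add: power2_eq_square)
  qed
  have sq_summ: "(\<lambda>m. W m * (norm (g m))\<^sup>2) summable_on UNIV" if "\<And>m. norm (g m) \<le> K" for g :: "int \<Rightarrow> complex"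
    unfolding W_def using that by (intro weighted_summable[OF r, of _ "K\<^sup>2"]) (simp add: power_mono)
  have in_summ: "(\<lambda>m. W m * (g m \<bullet> h m)) summable_on UNIV"
    if "\<And>m. norm (g m) \<le> K" "\<And>m. norm (h m) \<le> K" for g h :: "int \<Rightarrow> complex"
    unfolding W_def using that inner_bd by (intro weighted_summable[OF r, of _ "K\<^sup>2"]) auto
  define P where "P = (\<lambda>m. W m * (g\<^sub>1 m \<bullet> g\<^sub>2 (m + 1)))"
  define Q where "Q = (\<lambda>m. W m * (g\<^sub>1 m \<bullet> g\<^sub>2 (m - 1)))"
  have Ps: "P summable_on UNIV" and Qs: "Q summable_on UNIV"
    unfolding P_def Q_def by (rule in_summ; use bound in blast)+
  have Ps': "(\<lambda>m. P (m + (-1))) summable_on UNIV" and Qs': "(\<lambda>m. Q (m + 1)) summable_on UNIV"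
    by (subst summable_on_shift_int; fact)+
  \<comment> \<open>Summation by parts: the mean acting on \<open>g\<^sub>2\<close> is moved, with the weight, onto \<open>g\<^sub>1\<close>.\<close>
  have "2 * a g\<^sub>1 = (\<Sum>\<^sub>\<infinity>m. P m + Q m)"
    unfolding a_def infsum_cmult_right'[symmetric]
  proof (rule infsum_cong)
    fix m
    have "P m + Q m = W m * (g\<^sub>1 m \<bullet> (g\<^sub>2 (m + 1) + g\<^sub>2 (m - 1)))"
      by (simp add: P_def Q_def inner_right_distrib algebra_simps)
    also have "\<dots> = 2 * (W m * (norm (g\<^sub>1 m))\<^sup>2)"
      by (simp only: mean1 mult_2 inner_right_distrib power2_norm_eq_inner) (simp add: algebra_simps)
    finally show "2 * (W m * (norm (g\<^sub>1 m))\<^sup>2) = P m + Q m" by simp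
  qed
  also have "\<dots> = (\<Sum>\<^sub>\<infinity>m. P m) + (\<Sum>\<^sub>\<infinity>m. Q m)" by (rule infsum_add[OF Ps Qs])
  also have "\<dots> = (\<Sum>\<^sub>\<infinity>m. P (m + (-1))) + (\<Sum>\<^sub>\<infinity>m. Q (m + 1))"
    by (simp only: infsum_shift_int)
  also have "\<dots> = (\<Sum>\<^sub>\<infinity>m. P (m + (-1)) + Q (m + 1))"
    by (rule infsum_add[OF Ps' Qs', symmetric])
  finally have eq: "2 * a g\<^sub>1 = (\<Sum>\<^sub>\<infinity>m. P (m + (-1)) + Q (m + 1))" .
  define N where "N = (\<lambda>g::int \<Rightarrow> complex. \<lambda>m. W m * (norm (g m))\<^sup>2)"
  define B where "B = (\<lambda>m. (\<theta> + \<epsilon>) * N g\<^sub>2 m + 1 / \<theta> * N g\<^sub>0 m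
      + \<epsilon> * (1 + \<epsilon>) / 2 * (N g\<^sub>1 (m + (-1)) + N g\<^sub>1 (m + 1)))"
  have Ns: "N g\<^sub>0 summable_on UNIV" "N g\<^sub>1 summable_on UNIV" "N g\<^sub>2 summable_on UNIV"
    unfolding N_def by (rule sq_summ; use bound in blast)+
  have Ns': "(\<lambda>m. N g\<^sub>1 (m + (-1))) summable_on UNIV" "(\<lambda>m. N g\<^sub>1 (m + 1)) summable_on UNIV"
    by (subst summable_on_shift_int; rule Ns)+
  have pt: "P (m + (-1)) + Q (m + 1) \<le> B m" for m
  proof -
    \<comment> \<open>Exchanging the weight at a neighbour for the weight at \<open>m\<close>; this is the only source of the error.\<close>
    have off: "W k * (g\<^sub>1 k \<bullet> g\<^sub>2 m) \<le> W m * (g\<^sub>1 k \<bullet> g\<^sub>2 m)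
        + \<epsilon> / 2 * N g\<^sub>2 m + \<epsilon> * (1 + \<epsilon>) / 2 * N g\<^sub>1 k" if k: "\<bar>m - k\<bar> = 1" for k
    proof -
      have w1: "W m \<le> (1 + \<epsilon>) * W k"
        unfolding W_def by (rule geometric_weight_ratio[OF \<epsilon>(1) k])
      have w2: "W k \<le> (1 + \<epsilon>) * W m"
        unfolding W_def by (rule geometric_weight_ratio[OF \<epsilon>(1)]) (use k in linarith)
      have "W m \<le> W k + \<epsilon> * W m"
      proof -
        have "(1 - \<epsilon>) * W m \<le> (1 - \<epsilon>) * ((1 + \<epsilon>) * W k)"
          using \<epsilon> by (intro mult_left_mono w1) auto
        also have "\<dots> = W k - \<epsilon>\<^sup>2 * W k" by (simp add: algebra_simps power2_eq_square)
        also have "\<dots> \<le> W k" using Wpos[of k] by simp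
        finally show ?thesis by (simp add: algebra_simps)
      qed
      then have dW: "\<bar>W k - W m\<bar> \<le> \<epsilon> * W m" using w2 by (simp add: abs_le_iff algebra_simps)
      have xy: "\<bar>g\<^sub>1 k \<bullet> g\<^sub>2 m\<bar> \<le> ((norm (g\<^sub>1 k))\<^sup>2 + (norm (g\<^sub>2 m))\<^sup>2) / 2"
      proof -
        have "\<bar>g\<^sub>1 k \<bullet> g\<^sub>2 m\<bar> \<le> norm (g\<^sub>1 k) * norm (g\<^sub>2 m)" by (rule Cauchy_Schwarz_ineq2)
        also have "\<dots> \<le> ((norm (g\<^sub>1 k))\<^sup>2 + (norm (g\<^sub>2 m))\<^sup>2) / 2"
          using sum_squares_bound[of "norm (g\<^sub>1 k)" "norm (g\<^sub>2 m)"] by simp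
        finally show ?thesis .
      qed
      have "(W k - W m) * (g\<^sub>1 k \<bullet> g\<^sub>2 m) \<le> \<bar>W k - W m\<bar> * \<bar>g\<^sub>1 k \<bullet> g\<^sub>2 m\<bar>"
        by (metis abs_ge_self abs_mult)
      also have "\<dots> \<le> (\<epsilon> * W m) * (((norm (g\<^sub>1 k))\<^sup>2 + (norm (g\<^sub>2 m))\<^sup>2) / 2)"
        using dW xy \<epsilon> Wpos[of m] by (intro mult_mono) auto
      also have "\<dots> = \<epsilon> / 2 * N g\<^sub>2 m + \<epsilon> / 2 * (W m * (norm (g\<^sub>1 k))\<^sup>2)"
        by (simp add: N_def algebra_simps)
      also have "\<dots> \<le> \<epsilon> / 2 * N g\<^sub>2 m + \<epsilon> / 2 * ((1 + \<epsilon>) * W k * (norm (g\<^sub>1 k))\<^sup>2)"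
        using \<epsilon> w1 by (intro add_left_mono mult_left_mono mult_right_mono) auto
      finally show ?thesis by (simp add: N_def algebra_simps add_divide_distrib)
    qed
    have "W m * (g\<^sub>1 (m - 1) \<bullet> g\<^sub>2 m) + W m * (g\<^sub>1 (m + 1) \<bullet> g\<^sub>2 m)
        = W m * ((g\<^sub>1 (m + 1) + g\<^sub>1 (m - 1)) \<bullet> g\<^sub>2 m)"
      by (simp add: inner_left_distrib algebra_simps)
    also have "\<dots> = W m * (2 * (g\<^sub>0 m \<bullet> g\<^sub>2 m))"
      by (simp only: mean0 mult_2 inner_left_distrib)
    also have "\<dots> \<le> W m * (\<theta> * (norm (g\<^sub>2 m))\<^sup>2 + 1 / \<theta> * (norm (g\<^sub>0 m))\<^sup>2)"
      using inner_weighted_young[OF \<theta>(1)] Wpos[of m] by (intro mult_left_mono) auto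
    also have "\<dots> = \<theta> * N g\<^sub>2 m + 1 / \<theta> * N g\<^sub>0 m" by (simp add: N_def algebra_simps)
    finally show ?thesis
      using off[of "m - 1"] off[of "m + 1"] by (simp add: B_def P_def Q_def algebra_simps)
  qed
  have "(\<lambda>m. P (m + (-1)) + Q (m + 1)) summable_on UNIV" by (rule summable_on_add[OF Ps' Qs'])
  moreover have B_sum: "((\<lambda>m. (\<theta> + \<epsilon>) * N g\<^sub>2 m + 1 / \<theta> * N g\<^sub>0 m
      + \<epsilon> * (1 + \<epsilon>) / 2 * (N g\<^sub>1 (m + (-1)) + N g\<^sub>1 (m + 1))) has_sum
      ((\<theta> + \<epsilon>) * a g\<^sub>2 + 1 / \<theta> * a g\<^sub>0 + \<epsilon> * (1 + \<epsilon>) / 2 * (a g\<^sub>1 + a g\<^sub>1))) UNIV"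
  proof -
    have hs: "(N g\<^sub>0 has_sum a g\<^sub>0) UNIV" "(N g\<^sub>1 has_sum a g\<^sub>1) UNIV" "(N g\<^sub>2 has_sum a g\<^sub>2) UNIV"
      using Ns[THEN has_sum_infsum] by (simp_all add: a_def N_def)
    have hs': "((\<lambda>m. N g\<^sub>1 (m + (-1))) has_sum a g\<^sub>1) UNIV" "((\<lambda>m. N g\<^sub>1 (m + 1)) has_sum a g\<^sub>1) UNIV"
      using Ns'[THEN has_sum_infsum] hs(2)[THEN infsumI] by (simp_all only: infsum_shift_int)
    show ?thesis
      by (intro has_sum_add has_sum_cmult_right hs hs')
  qed
  then have Bs: "(B has_sum ((\<theta> + \<epsilon>) * a g\<^sub>2 + 1 / \<theta> * a g\<^sub>0 + \<epsilon> * (1 + \<epsilon>) * a g\<^sub>1)) UNIV"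
    by (simp add: B_def mult.assoc)
  ultimately have "2 * a g\<^sub>1 \<le> (\<theta> + \<epsilon>) * a g\<^sub>2 + 1 / \<theta> * a g\<^sub>0 + \<epsilon> * (1 + \<epsilon>) * a g\<^sub>1"
    unfolding eq infsumI[OF Bs, symmetric] using Bs pt
    by (intro infsum_mono) (auto simp: summable_on_def)
  moreover have "1 / \<theta> * a g\<^sub>0 \<le> a g\<^sub>1"
    using le \<theta> by (simp add: a_def field_simps)
  ultimately have main: "(1 - \<epsilon> * (1 + \<epsilon>)) * a g\<^sub>1 \<le> (\<theta> + \<epsilon>) * a g\<^sub>2"
    by (simp add: algebra_simps)
  have a0: "a g\<^sub>2 \<ge> 0" unfolding a_def by (intro infsum_nonneg) (simp add: Wpos less_imp_le)
  have coef: "\<theta> + \<epsilon> \<le> (1 - \<epsilon> * (1 + \<epsilon>)) * (\<theta> + 4 * \<epsilon>)"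
  proof -
    have e2: "\<epsilon> * \<epsilon> \<le> 1/4 * \<epsilon>" using \<epsilon> by (intro mult_right_mono) auto
    have "1 - 5/4 * \<epsilon> \<le> 1 - \<epsilon> * (1 + \<epsilon>)" using e2 by (simp add: algebra_simps)
    then have "(1 - 5/4 * \<epsilon>) * (\<theta> + 4 * \<epsilon>) \<le> (1 - \<epsilon> * (1 + \<epsilon>)) * (\<theta> + 4 * \<epsilon>)"
      using \<epsilon> \<theta> by (intro mult_right_mono) auto
    moreover have "\<epsilon> * \<theta> \<le> \<epsilon> * 1" using \<epsilon> \<theta> by (intro mult_left_mono) auto
    moreover have "(1 - 5/4 * \<epsilon>) * (\<theta> + 4 * \<epsilon>) = \<theta> + 4 * \<epsilon> - 5/4 * (\<epsilon> * \<theta>) - 5 * (\<epsilon> * \<epsilon>)"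
      by (simp add: algebra_simps)
    ultimately show ?thesis using e2 \<epsilon> by linarith
  qed
  have "(1 - \<epsilon> * (1 + \<epsilon>)) * a g\<^sub>1 \<le> (1 - \<epsilon> * (1 + \<epsilon>)) * ((\<theta> + 4 * \<epsilon>) * a g\<^sub>2)"
    using main mult_right_mono[OF coef a0] by (simp add: mult.assoc)
  moreover have "1 - \<epsilon> * (1 + \<epsilon>) > 0"
  proof -
    have "\<epsilon> * \<epsilon> \<le> 1/4 * \<epsilon>" using \<epsilon> by (intro mult_right_mono) auto
    moreover have "\<epsilon> * (1 + \<epsilon>) = \<epsilon> + \<epsilon> * \<epsilon>" by (simp add: algebra_simps)
    ultimately show ?thesis using \<epsilon> by linarith
  qed
  ultimately show ?thesis unfolding a_def by (simp only: mult_le_cancel_left_pos)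
qed

text \<open>
  Iterating the step: the error accumulates only additively in the ratio, so with \<open>\<epsilon>\<close> of order \<open>1 / n\<close>
  the ratio stays below a fixed \<open>\<theta>'\<close> for \<open>n\<close> steps and the energies grow geometrically.
\<close>

lemma weighted_energy_growth:
  fixes g :: "nat \<Rightarrow> int \<Rightarrow> complex" and \<epsilon> \<theta> \<theta>' \<kappa> K :: real
  defines "a \<equiv> \<lambda>n. \<Sum>\<^sub>\<infinity>m::int. (1 / (1 + \<epsilon>)) ^ nat \<bar>m\<bar> * (norm (g n m))\<^sup>2"
  assumes \<epsilon>: "0 < \<epsilon>" "\<epsilon> \<le> 1/4" and \<theta>: "0 < \<theta>" "\<theta> + 4 * real n * \<epsilon> \<le> \<theta>'" "\<theta>' \<le> 1"
    and \<kappa>: "1 \<le> \<kappa>" and bound: "\<And>n m. norm (g n m) \<le> K * \<kappa> ^ n"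
    and mean: "\<And>n m. g (Suc n) (m + 1) + g (Suc n) (m - 1) = 2 * g n m"
    and le: "a 0 \<le> \<theta> * a 1"
  shows "a 1 \<le> \<theta>' ^ n * a (Suc n)"
proof -
  have K0: "K \<ge> 0" using order_trans[OF norm_ge_zero bound[of 0 0]] by simp
  have anon: "a j \<ge> 0" for j unfolding a_def using \<epsilon> by (intro infsum_nonneg) simp
  have step: "a j \<le> (\<theta> + 4 * real j * \<epsilon>) * a (Suc j)" if "j \<le> n" for j
    using that
  proof (induction j)
    case 0
    then show ?case using le by simp
  next
    case (Suc j)
    have "\<theta> + 4 * real j * \<epsilon> \<le> \<theta> + 4 * real n * \<epsilon>"
      using Suc.prems \<epsilon> by (intro add_left_mono mult_right_mono) auto
    then have t1: "\<theta> + 4 * real j * \<epsilon> \<le> 1" using \<theta> by linarith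
    have pw: "K * \<kappa> ^ i \<le> K * \<kappa> ^ (Suc (Suc j))" if "i \<le> Suc (Suc j)" for i
      using K0 \<kappa> that by (intro mult_left_mono power_increasing) auto
    have "a (Suc j) \<le> (\<theta> + 4 * real j * \<epsilon> + 4 * \<epsilon>) * a (Suc (Suc j))"
      unfolding a_def
    proof (rule weighted_energy_step[of _ _ "g j" "K * \<kappa> ^ (Suc (Suc j))"])
      show "(\<Sum>\<^sub>\<infinity>m::int. (1 / (1 + \<epsilon>)) ^ nat \<bar>m\<bar> * (norm (g j m))\<^sup>2)
          \<le> (\<theta> + 4 * real j * \<epsilon>) * (\<Sum>\<^sub>\<infinity>m::int. (1 / (1 + \<epsilon>)) ^ nat \<bar>m\<bar> * (norm (g (Suc j) m))\<^sup>2)"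
        using Suc unfolding a_def by simp
      show "norm (g j m) \<le> K * \<kappa> ^ (Suc (Suc j))" for m
        using order_trans[OF bound pw] by simp
      show "norm (g (Suc j) m) \<le> K * \<kappa> ^ (Suc (Suc j))" for m
        using order_trans[OF bound pw] by simp
      show "norm (g (Suc (Suc j)) m) \<le> K * \<kappa> ^ (Suc (Suc j))" for m
        by (rule bound)
    qed (use \<epsilon> \<theta> t1 mean in \<open>auto intro: add_pos_nonneg\<close>)
    then show ?case by (simp add: algebra_simps)
  qed
  have "a 1 \<le> \<theta>' ^ j * a (Suc j)" if "j \<le> n" for j
    using that
  proof (induction j)
    case (Suc j)
    have "\<theta> + 4 * real (Suc j) * \<epsilon> \<le> \<theta> + 4 * real n * \<epsilon>"
      using Suc.prems \<epsilon> by (intro add_left_mono mult_right_mono) auto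
    then have "(\<theta> + 4 * real (Suc j) * \<epsilon>) * a (Suc (Suc j)) \<le> \<theta>' * a (Suc (Suc j))"
      using \<theta> anon by (intro mult_right_mono) auto
    then have "a (Suc j) \<le> \<theta>' * a (Suc (Suc j))" using step[OF Suc.prems] by linarith
    moreover have "0 \<le> \<theta>'" using \<theta> \<epsilon> by (smt (verit) mult_nonneg_nonneg of_nat_0_le_iff)
    ultimately have "\<theta>' ^ j * a (Suc j) \<le> \<theta>' ^ j * (\<theta>' * a (Suc (Suc j)))"
      by (intro mult_left_mono) auto
    then show ?case using Suc by (simp add: mult.assoc mult.commute mult.left_commute)
  qed simp
  then show ?thesis by simp
qed

text \<open>
  If the inequality failed, the first ratio of energies would be below some \<open>\<theta> < \<kappa>\<^sup>-\<^sup>2\<close>. By log-convexity the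
  energies of \<open>g n\<close> would then grow at least like \<open>\<theta>'\<^sup>-\<^sup>n\<close> with \<open>\<theta>' < \<kappa>\<^sup>-\<^sup>2\<close>, whereas the pointwise bound
  allows only \<open>\<kappa>\<^sup>2\<^sup>n\<close> times the total weight. That weight is of order \<open>1 / \<epsilon>\<close>, hence of order \<open>n\<close>, too
  small to compensate the geometric gap.
\<close>

lemma bounded_preimages_energy:
  fixes g :: "nat \<Rightarrow> int \<Rightarrow> complex" and \<kappa> K :: real
  assumes \<kappa>: "1 \<le> \<kappa>" and bound: "\<And>n m. norm (g n m) \<le> K * \<kappa> ^ n"
    and mean: "\<And>n m. g (Suc n) (m + 1) + g (Suc n) (m - 1) = 2 * g n m"
    and sq0: "(\<lambda>m. (norm (g 0 m))\<^sup>2) summable_on UNIV"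
    and sq1: "(\<lambda>m. (norm (g 1 m))\<^sup>2) summable_on UNIV"
  shows "(\<Sum>\<^sub>\<infinity>m. (norm (g 1 m))\<^sup>2) \<le> \<kappa>\<^sup>2 * (\<Sum>\<^sub>\<infinity>m. (norm (g 0 m))\<^sup>2)"
proof (rule ccontr)
  define E0 where "E0 = (\<Sum>\<^sub>\<infinity>m. (norm (g 0 m))\<^sup>2)"
  define E1 where "E1 = (\<Sum>\<^sub>\<infinity>m. (norm (g 1 m))\<^sup>2)"
  assume "\<not> (\<Sum>\<^sub>\<infinity>m. (norm (g 1 m))\<^sup>2) \<le> \<kappa>\<^sup>2 * (\<Sum>\<^sub>\<infinity>m. (norm (g 0 m))\<^sup>2)"
  then have lt: "\<kappa>\<^sup>2 * E0 < E1" by (simp add: E0_def E1_def)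
  have E0: "E0 \<ge> 0" unfolding E0_def by (intro infsum_nonneg) simp
  then have E1: "E1 > 0" using lt by (smt (verit) mult_nonneg_nonneg zero_le_power2)
  have \<kappa>2: "\<kappa>\<^sup>2 \<ge> 1" using \<kappa> by (rule one_le_power)
  have "max 0 (E0 / E1) < 1 / \<kappa>\<^sup>2"
    using lt E1 \<kappa> by (auto simp: pos_divide_less_eq pos_less_divide_eq mult.commute)
  then obtain \<theta> where "max 0 (E0 / E1) < \<theta>" and \<theta>lt: "\<theta> < 1 / \<kappa>\<^sup>2" using dense by blast
  then have \<theta>: "0 < \<theta>" and "E0 < \<theta> * E1" using E1 by (auto simp: field_simps)
  obtain \<theta>' where \<theta>': "\<theta> < \<theta>'" "\<theta>' < 1 / \<kappa>\<^sup>2" using dense[OF \<theta>lt] by blast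
  have "1 / \<kappa>\<^sup>2 \<le> 1" using frac_le[of 1 1 1 "\<kappa>\<^sup>2"] \<kappa>2 by simp
  then have \<theta>'1: "\<theta>' < 1" using \<theta>' by linarith
  have "E0 / \<theta> < E1" using \<open>E0 < \<theta> * E1\<close> \<theta> by (simp add: field_simps)
  then obtain S where S: "finite S" "E0 / \<theta> < (\<Sum>m\<in>S. (norm (g 1 m))\<^sup>2)"
    using infsum_le_finite_sums[OF sq1, of "E0 / \<theta>"] unfolding E1_def by (meson linorder_not_less subset_UNIV)
  obtain Q where Q: "E0 / \<theta> < Q" "Q < (\<Sum>m\<in>S. (norm (g 1 m))\<^sup>2)" using dense[OF S(2)] by blast
  have Q0: "Q > 0" using Q(1) E0 \<theta> by (smt (verit) divide_nonneg_pos)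
  \<comment> \<open>The largest \<open>\<epsilon>\<close> for which the ratio reaches at most \<open>\<theta>'\<close> after \<open>n\<close> steps.\<close>
  define \<epsilon> where "\<epsilon> = (\<lambda>n. (\<theta>' - \<theta>) / (4 * real n))"
  define a where "a = (\<lambda>n j. \<Sum>\<^sub>\<infinity>m::int. (1 / (1 + \<epsilon> n)) ^ nat \<bar>m\<bar> * (norm (g j m))\<^sup>2)"
  define q where "q = \<theta>' * \<kappa>\<^sup>2"
  define C where "C = 16 * K\<^sup>2 * \<kappa>\<^sup>2 / (\<theta>' - \<theta>)"
  have ub: "a n 1 \<le> C * (real n * q ^ n)" and lb: "(\<Sum>m\<in>S. (1 / (1 + \<epsilon> n)) ^ nat \<bar>m\<bar> * (norm (g 1 m))\<^sup>2) \<le> a n 1"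
    if n: "n > 0" and big: "Q < (\<Sum>m\<in>S. (1 / (1 + \<epsilon> n)) ^ nat \<bar>m\<bar> * (norm (g 1 m))\<^sup>2)" for n
  proof -
    have \<epsilon>: "0 < \<epsilon> n" "\<epsilon> n \<le> 1/4"
      using n \<theta> \<theta>' \<theta>'1 by (auto simp: \<epsilon>_def field_simps)
    have r: "0 < 1 / (1 + \<epsilon> n)" "1 / (1 + \<epsilon> n) < 1" using \<epsilon> by auto
    have summ: "(\<lambda>m::int. (1 / (1 + \<epsilon> n)) ^ nat \<bar>m\<bar> * (norm (g j m))\<^sup>2) summable_on UNIV" for j
      using bound by (intro weighted_summable[OF r, of _ "(K * \<kappa> ^ j)\<^sup>2"]) (simp add: power_mono)
    show lb: "(\<Sum>m\<in>S. (1 / (1 + \<epsilon> n)) ^ nat \<bar>m\<bar> * (norm (g 1 m))\<^sup>2) \<le> a n 1"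
      unfolding a_def using summ S(1) \<epsilon> by (intro finite_sum_le_infsum) auto
    have "a n 0 \<le> E0"
      unfolding a_def E0_def
    proof (rule infsum_mono[OF summ sq0])
      fix m
      have "(1 / (1 + \<epsilon> n)) ^ nat \<bar>m\<bar> \<le> 1" using \<epsilon> by (intro power_le_one) auto
      then show "(1 / (1 + \<epsilon> n)) ^ nat \<bar>m\<bar> * (norm (g 0 m))\<^sup>2 \<le> (norm (g 0 m))\<^sup>2"
        by (intro mult_left_le_one_le) (use \<epsilon> in auto)
    qed
    also have "E0 \<le> \<theta> * Q" using Q(1) \<theta> by (simp add: field_simps)
    also have "\<dots> \<le> \<theta> * a n 1" using big lb \<theta> by (intro mult_left_mono) auto
    finally have "a n 0 \<le> \<theta> * a n 1" .
    then have "a n 1 \<le> \<theta>' ^ n * a n (Suc n)"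
      unfolding a_def using \<theta> \<theta>' \<theta>'1 \<epsilon> n \<kappa> bound mean
      by (intro weighted_energy_growth[where \<theta> = \<theta> and \<kappa> = \<kappa> and K = K]) (auto simp: \<epsilon>_def)
    also have "a n (Suc n) \<le> (K * \<kappa> ^ Suc n)\<^sup>2 * (4 / \<epsilon> n)"
    proof -
      have "a n (Suc n) \<le> (\<Sum>\<^sub>\<infinity>m::int. (K * \<kappa> ^ Suc n)\<^sup>2 * (1 / (1 + \<epsilon> n)) ^ nat \<bar>m\<bar>)"
        unfolding a_def
      proof (rule infsum_mono[OF summ summable_on_cmult_right[OF geometric_weight_int(1)[OF r]]])
        fix m
        have "(norm (g (Suc n) m))\<^sup>2 \<le> (K * \<kappa> ^ Suc n)\<^sup>2" by (intro power_mono bound) auto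
        then show "(1 / (1 + \<epsilon> n)) ^ nat \<bar>m\<bar> * (norm (g (Suc n) m))\<^sup>2
            \<le> (K * \<kappa> ^ Suc n)\<^sup>2 * (1 / (1 + \<epsilon> n)) ^ nat \<bar>m\<bar>"
          using r by (subst mult.commute) (intro mult_right_mono, auto)
      qed
      also have "\<dots> = (K * \<kappa> ^ Suc n)\<^sup>2 * (\<Sum>\<^sub>\<infinity>m::int. (1 / (1 + \<epsilon> n)) ^ nat \<bar>m\<bar>)"
        by (rule infsum_cmult_right')
      also have "(\<Sum>\<^sub>\<infinity>m::int. (1 / (1 + \<epsilon> n)) ^ nat \<bar>m\<bar>) \<le> 2 / (1 - 1 / (1 + \<epsilon> n))"
        by (rule geometric_weight_int(2)[OF r])
      also have "2 / (1 - 1 / (1 + \<epsilon> n)) \<le> 4 / \<epsilon> n"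
        using \<epsilon> by (simp add: field_simps)
      finally show ?thesis by (simp add: mult_left_mono)
    qed
    also have "\<theta>' ^ n * ((K * \<kappa> ^ Suc n)\<^sup>2 * (4 / \<epsilon> n)) = C * (real n * q ^ n)"
      using n \<theta>' by (simp add: C_def q_def \<epsilon>_def power_mult_distrib power_even_eq field_simps flip: power_mult)
    finally show "a n 1 \<le> C * (real n * q ^ n)" using \<theta> \<theta>' by (simp add: mult_left_mono)
  qed
  have \<epsilon>0: "\<epsilon> \<longlonglongrightarrow> 0"
  proof -
    have "(\<lambda>n. (\<theta>' - \<theta>) / 4 * (1 / real n)) \<longlonglongrightarrow> (\<theta>' - \<theta>) / 4 * 0"
      by (intro tendsto_mult_left lim_1_over_n)
    then show ?thesis by (simp add: \<epsilon>_def)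
  qed
  have "(\<lambda>n. \<Sum>m\<in>S. (1 / (1 + \<epsilon> n)) ^ nat \<bar>m\<bar> * (norm (g 1 m))\<^sup>2)
      \<longlonglongrightarrow> (\<Sum>m\<in>S. (1 / (1 + 0)) ^ nat \<bar>m\<bar> * (norm (g 1 m))\<^sup>2)"
    by (intro tendsto_intros \<epsilon>0) auto
  then have "\<forall>\<^sub>F n in sequentially. Q < (\<Sum>m\<in>S. (1 / (1 + \<epsilon> n)) ^ nat \<bar>m\<bar> * (norm (g 1 m))\<^sup>2)"
    using Q(2) by (intro order_tendstoD) auto
  moreover have "\<forall>\<^sub>F n in sequentially. C * (real n * q ^ n) < Q"
  proof -
    have "q < 1" using \<theta>'(2) \<kappa> by (simp add: q_def pos_less_divide_eq)
    moreover have "0 \<le> q" using \<theta> \<theta>' by (simp add: q_def)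
    ultimately have "norm q < 1" by simp
    then have "(\<lambda>n. C * (real n * q ^ n)) \<longlonglongrightarrow> C * 0"
      by (intro tendsto_mult_left powser_times_n_limit_0)
    then show ?thesis using Q0 by (intro order_tendstoD) auto
  qed
  moreover have "\<forall>\<^sub>F n in sequentially. n > (0::nat)" by (rule eventually_gt_at_top)
  ultimately have "\<forall>\<^sub>F n in sequentially. False"
  proof eventually_elim
    case (elim n)
    then show False using ub[of n] lb[of n] by linarith
  qed
  then show False by simp
qed

section \<open>Discrete entire functions and spectral localization\<close>

definition horizontal_mean :: "(int \<times> int \<Rightarrow> complex) \<Rightarrow> int \<times> int \<Rightarrow> complex" where
  "horizontal_mean F = (\<lambda>(m, n). (F (m + 1, n) + F (m - 1, n)) / 2)"

definition vertical_mean :: "(int \<times> int \<Rightarrow> complex) \<Rightarrow> int \<times> int \<Rightarrow> complex" where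
  "vertical_mean F = (\<lambda>(m, n). (F (m, n + 1) + F (m, n - 1)) / 2)"

lemma means_commute: "horizontal_mean (vertical_mean F) = vertical_mean (horizontal_mean F)"
  by (auto simp: horizontal_mean_def vertical_mean_def fun_eq_iff field_simps)

text \<open>
  Adding the defining relation over the four unit squares around a point cancels all terms at the
  horizontal and vertical neighbours; the four diagonal neighbours remain and average to the centre.
\<close>

lemma discrete_entire_imp_harmonic:
  assumes "discrete_entire F"
  shows "horizontal_mean (vertical_mean F) = F"
proof
  fix z :: "int \<times> int"
  obtain m n where z: "z = (m, n)" by (cases z)
  have E: "F (j + 1, k + 1) - F (j, k) = - \<i> * (F (j, k + 1) - F (j + 1, k))" for j k
    using assms by (simp add: discrete_entire_def)
  have E': "F (j, k + 1) - F (j + 1, k) = \<i> * (F (j + 1, k + 1) - F (j, k))" for j k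
    unfolding E by (simp flip: mult.assoc)
  have ne: "F (m + 1, n + 1) = F (m, n) + \<i> * F (m + 1, n) - \<i> * F (m, n + 1)"
    using E[of m n] by (simp add: algebra_simps)
  have sw: "F (m - 1, n - 1) = F (m, n) + \<i> * F (m - 1, n) - \<i> * F (m, n - 1)"
    using E[of "m - 1" "n - 1"] by (simp add: algebra_simps)
  have nw: "F (m - 1, n + 1) = F (m, n) + \<i> * F (m, n + 1) - \<i> * F (m - 1, n)"
    using E'[of "m - 1" n] by (simp add: algebra_simps)
  have se: "F (m + 1, n - 1) = F (m, n) + \<i> * F (m, n - 1) - \<i> * F (m + 1, n)"
    using E'[of m "n - 1"] by (simp add: algebra_simps)
  show "horizontal_mean (vertical_mean F) z = F z"
    by (simp add: z horizontal_mean_def vertical_mean_def ne sw nw se) (simp add: field_simps)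
qed

lemma horizontal_mean_iterate:
  assumes "horizontal_mean (vertical_mean F) = F"
  shows "horizontal_mean (vertical_mean ((vertical_mean ^^ n) F)) = (vertical_mean ^^ n) F"
proof (induction n)
  case (Suc n)
  then show ?case by (simp add: means_commute)
qed (use assms in simp)

text \<open>
  The bound is stated with \<open>\<rho>\<^sup>n + \<rho>\<^sup>-\<^sup>n\<close> in place of \<open>\<rho> ^ \<bar>n\<bar>\<close> because this function of \<open>n\<close> is an
  eigenfunction of the vertical mean, which makes the growth factor in \<open>k\<close> sharp.
\<close>

lemma vertical_mean_growth:
  fixes \<rho> c :: real
  assumes \<rho>: "\<rho> > 0"
    and bound: "\<And>m n. norm (F (m, n)) \<le> c * (\<rho> powi n + \<rho> powi (- n))"
  shows "norm ((vertical_mean ^^ k) F (m, n)) \<le> c * ((\<rho> + 1 / \<rho>) / 2) ^ k * (\<rho> powi n + \<rho> powi (- n))"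
proof (induction k arbitrary: m n)
  case (Suc k)
  define G where "G = (vertical_mean ^^ k) F"
  define b where "b = c * ((\<rho> + 1 / \<rho>) / 2) ^ k"
  have IH: "norm (G (m, n)) \<le> b * (\<rho> powi n + \<rho> powi (- n))" for m n
    using Suc by (simp add: G_def b_def)
  have "norm ((vertical_mean ^^ Suc k) F (m, n)) = norm (G (m, n + 1) + G (m, n - 1)) / 2"
    by (simp add: G_def vertical_mean_def norm_divide)
  also have "\<dots> \<le> (norm (G (m, n + 1)) + norm (G (m, n - 1))) / 2"
    by (intro divide_right_mono norm_triangle_ineq) auto
  also have "\<dots> \<le> (b * (\<rho> powi (n + 1) + \<rho> powi (- (n + 1)))
      + b * (\<rho> powi (n - 1) + \<rho> powi (- (n - 1)))) / 2"
    by (intro divide_right_mono add_mono IH) auto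
  also have "\<dots> = b * ((\<rho> + 1 / \<rho>) / 2) * (\<rho> powi n + \<rho> powi (- n))"
  proof -
    have neg: "- (n + 1) = - n - 1" "- (n - 1) = - n + 1" by auto
    have pw: "\<rho> powi (n + 1) = \<rho> powi n * \<rho>" "\<rho> powi (n - 1) = \<rho> powi n / \<rho>"
      "\<rho> powi (- n - 1) = \<rho> powi (- n) / \<rho>" "\<rho> powi (- n + 1) = \<rho> powi (- n) * \<rho>"
      using power_int_add[of \<rho> n 1] power_int_diff[of \<rho> n 1]
        power_int_diff[of \<rho> "- n" 1] power_int_add[of \<rho> "- n" 1] \<rho>
      by (simp_all only: power_int_1_right less_irrefl simp_thms less_imp_neq[symmetric] not_False_eq_True)
    show ?thesis unfolding neg pw by (simp add: algebra_simps add_divide_distrib)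
  qed
  finally show ?case by (simp add: b_def algebra_simps)
qed (use bound in simp)

text \<open>
  The modulus of the exponential is \<open>\<rho> = (1 + sin \<alpha>) / cos \<alpha>\<close>, and its inverse is
  \<open>(1 - sin \<alpha>) / cos \<alpha>\<close>. The mean of the two is the factor by which vertical means can grow.
\<close>

lemma discrete_exp_growth_rate:
  fixes \<alpha> \<rho> :: real
  defines "\<rho> \<equiv> norm (discrete_exp (- \<alpha>) (0, 1))"
  assumes "0 < \<alpha>" "\<alpha> < pi / 2"
  shows "1 \<le> \<rho>" and "(\<rho> + 1 / \<rho>) / 2 = 1 / cos \<alpha>"
proof -
  have e: "exp (\<i> * of_real (- \<alpha>)) = Complex (cos \<alpha>) (- sin \<alpha>)"
    by (simp only: cis_conv_exp[symmetric]) (simp add: complex_eq_iff)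
  have s: "0 < sin \<alpha>" "sin \<alpha> < 1"
    using assms sin_gt_zero[of \<alpha>] sin_monotone_2pi[of \<alpha> "pi / 2"] by auto
  have c: "0 < cos \<alpha>" using assms by (intro cos_gt_zero) auto
  have sc: "(cos \<alpha>)\<^sup>2 = (1 - sin \<alpha>) * (1 + sin \<alpha>)"
    by (simp add: cos_squared_eq power2_eq_square algebra_simps)
  have "\<rho> = norm (1 + \<i> * Complex (cos \<alpha>) (- sin \<alpha>)) / norm (\<i> + Complex (cos \<alpha>) (- sin \<alpha>))"
    unfolding \<rho>_def discrete_exp_def using e by (simp add: norm_divide)
  also have "norm (1 + \<i> * Complex (cos \<alpha>) (- sin \<alpha>)) = sqrt (2 * (1 + sin \<alpha>))"
    by (simp add: cmod_def sc power2_eq_square algebra_simps)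
  also have "norm (\<i> + Complex (cos \<alpha>) (- sin \<alpha>)) = sqrt (2 * (1 - sin \<alpha>))"
    by (simp add: cmod_def sc power2_eq_square algebra_simps)
  also have "sqrt (2 * (1 + sin \<alpha>)) / sqrt (2 * (1 - sin \<alpha>)) = (1 + sin \<alpha>) / cos \<alpha>"
  proof -
    have ne: "2 * (1 - sin \<alpha>) \<noteq> 0" "(1 - sin \<alpha>) * (1 + sin \<alpha>) \<noteq> 0" using s by auto
    have "2 * (1 + sin \<alpha>) / (2 * (1 - sin \<alpha>)) = ((1 + sin \<alpha>) / cos \<alpha>)\<^sup>2"
      unfolding power_divide sc frac_eq_eq[OF ne] by (simp add: power2_eq_square algebra_simps)
    then show ?thesis using s c by (simp add: real_sqrt_divide[symmetric])
  qed
  finally have \<rho>: "\<rho> = (1 + sin \<alpha>) / cos \<alpha>" .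
  have "cos \<alpha> \<le> 1 + sin \<alpha>" using s cos_le_one[of \<alpha>] by linarith
  then show "1 \<le> \<rho>" unfolding \<rho> using s c by (simp add: field_simps)
  have "1 / \<rho> = (1 - sin \<alpha>) / cos \<alpha>"
    unfolding \<rho> using s c sc by (simp add: frac_eq_eq power2_eq_square)
  then have "\<rho> + 1 / \<rho> = ((1 + sin \<alpha>) + (1 - sin \<alpha>)) / cos \<alpha>"
    by (simp only: \<rho> add_divide_distrib)
  then have "\<rho> + 1 / \<rho> = 2 / cos \<alpha>" by simp
  then show "(\<rho> + 1 / \<rho>) / 2 = 1 / cos \<alpha>" by simp
qed

text \<open>
  The Bernstein inequality for \<open>PW \<alpha>\<close>. The vertical iterates start from the horizontal mean of \<open>F\<close>,
  so that \<open>g 0\<close> is the horizontal mean of the row \<open>f\<close> and \<open>g 1\<close> is \<open>f\<close> itself.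
\<close>

lemma PW_double_difference:
  assumes "0 < \<alpha>" "\<alpha> < pi / 2" and F: "F \<in> PW \<alpha>"
  shows "(\<lambda>m. (norm (F (m + 2, 0) - F (m, 0)))\<^sup>2) summable_on UNIV"
    and "(\<Sum>\<^sub>\<infinity>m. (norm (F (m + 2, 0) - F (m, 0)))\<^sup>2) \<le> 4 * (sin \<alpha>)\<^sup>2 * (\<Sum>\<^sub>\<infinity>m. (norm (F (m, 0)))\<^sup>2)"
proof -
  define \<rho> where "\<rho> = norm (discrete_exp (- \<alpha>) (0, 1))"
  define f where "f = (\<lambda>m. F (m, 0))"
  define \<kappa> where "\<kappa> = 1 / cos \<alpha>"
  define H where "H = horizontal_mean F"
  define g where "g = (\<lambda>k m. (vertical_mean ^^ k) H (m, 0))"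
  note rate = discrete_exp_growth_rate[OF assms(1,2), folded \<rho>_def]
  have cpos: "0 < cos \<alpha>" using assms by (intro cos_gt_zero) auto
  have \<kappa>1: "1 \<le> \<kappa>" using cpos by (simp add: \<kappa>_def)
  obtain c where c: "c > 0" "\<And>m n. norm (F (m, n)) \<le> c * \<rho> ^ nat \<bar>n\<bar>"
    using F by (auto simp: PW_def \<rho>_def)
  have fsum: "(\<lambda>m. (norm (f m))\<^sup>2) summable_on UNIV" using F by (simp add: PW_def f_def)
  have harm: "horizontal_mean (vertical_mean F) = F"
    using F by (intro discrete_entire_imp_harmonic) (simp add: PW_def)
  have Fb: "norm (F (m, n)) \<le> c * (\<rho> powi n + \<rho> powi (- n))" for m n
  proof -
    have "\<rho> ^ nat \<bar>n\<bar> \<le> \<rho> powi n + \<rho> powi (- n)"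
      using rate(1) by (cases "n \<ge> 0") (auto simp: power_int_def)
    then have "c * \<rho> ^ nat \<bar>n\<bar> \<le> c * (\<rho> powi n + \<rho> powi (- n))"
      using c(1) by (intro mult_left_mono) auto
    then show ?thesis using c(2)[of m n] by linarith
  qed
  have Hb: "norm (H (m, n)) \<le> c * (\<rho> powi n + \<rho> powi (- n))" for m n
  proof -
    have "norm (H (m, n)) = norm (F (m + 1, n) + F (m - 1, n)) / 2"
      by (simp add: H_def horizontal_mean_def norm_divide)
    also have "\<dots> \<le> (norm (F (m + 1, n)) + norm (F (m - 1, n))) / 2"
      by (intro divide_right_mono norm_triangle_ineq) auto
    also have "\<dots> \<le> (c * (\<rho> powi n + \<rho> powi (- n)) + c * (\<rho> powi n + \<rho> powi (- n))) / 2"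
      by (intro divide_right_mono add_mono Fb) auto
    finally show ?thesis by simp
  qed
  have gb: "norm (g k m) \<le> 2 * c * \<kappa> ^ k" for k m
    using vertical_mean_growth[of \<rho> H c k m 0] Hb rate
    by (simp add: g_def \<kappa>_def mult.commute)
  have Hharm: "horizontal_mean (vertical_mean H) = H"
    unfolding H_def means_commute[symmetric] harm ..
  have gmean: "g (Suc k) (m + 1) + g (Suc k) (m - 1) = 2 * g k m" for k m
    using fun_cong[OF horizontal_mean_iterate[OF Hharm, of k], of "(m, 0)"]
    by (simp add: g_def horizontal_mean_def)
  have g1: "g 1 = f" using harm by (simp add: g_def H_def f_def means_commute)
  have g0: "g 0 m = (f (m + 1) + f (m - 1)) / 2" for m
    by (simp add: g_def H_def f_def horizontal_mean_def)
  define E where "E = (\<Sum>\<^sub>\<infinity>m. (norm (f m))\<^sup>2)"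
  have hs: "((\<lambda>m. (norm (f m))\<^sup>2) has_sum E) UNIV" unfolding E_def using fsum by (rule has_sum_infsum)
  have hs_shift: "((\<lambda>m. (norm (f (m + k)))\<^sup>2) has_sum E) UNIV" for k
    using fsum summable_on_shift_int[of "\<lambda>m. (norm (f m))\<^sup>2" k] infsum_shift_int[of "\<lambda>m. (norm (f m))\<^sup>2" k]
    unfolding E_def by (metis has_sum_infsum)
  define d where "d = (\<lambda>m. (norm (f (m + 2) - f m))\<^sup>2)"
  have para: "d (m + (-1)) = 2 * (norm (f (m + 1)))\<^sup>2 + 2 * (norm (f (m + (-1))))\<^sup>2 + - 4 * (norm (g 0 m))\<^sup>2" for m
  proof -
    have "(norm (f (m + 1) - f (m - 1)))\<^sup>2 + (norm (f (m + 1) + f (m - 1)))\<^sup>2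
        = 2 * (norm (f (m + 1)))\<^sup>2 + 2 * (norm (f (m - 1)))\<^sup>2"
      by (simp add: power2_norm_eq_inner algebra_simps inner_commute)
    then show ?thesis by (simp add: d_def g0 norm_divide power_divide algebra_simps)
  qed
  have g0sum: "(\<lambda>m. (norm (g 0 m))\<^sup>2) summable_on UNIV"
  proof (rule summable_on_comparison_test)
    show "(\<lambda>m. (norm (f (m + 1)))\<^sup>2 + (norm (f (m + (-1))))\<^sup>2) summable_on UNIV"
      by (rule summable_on_add[OF has_sum_imp_summable[OF hs_shift] has_sum_imp_summable[OF hs_shift]])
    show "(norm (g 0 m))\<^sup>2 \<le> (norm (f (m + 1)))\<^sup>2 + (norm (f (m + (-1))))\<^sup>2" for m
      using para[of m] zero_le_power2[of "norm (f (m + 2 + (-1)) - f (m + (-1)))"]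
      by (simp add: d_def) (smt (verit) zero_le_power2)
  qed auto
  have "((\<lambda>m. d (m + (-1))) has_sum (2 * E + 2 * E + - 4 * (\<Sum>\<^sub>\<infinity>m. (norm (g 0 m))\<^sup>2))) UNIV"
  proof -
    have "((\<lambda>m. 2 * (norm (f (m + 1)))\<^sup>2 + 2 * (norm (f (m + (-1))))\<^sup>2 + - 4 * (norm (g 0 m))\<^sup>2)
        has_sum (2 * E + 2 * E + - 4 * (\<Sum>\<^sub>\<infinity>m. (norm (g 0 m))\<^sup>2))) UNIV"
      by (intro has_sum_add has_sum_cmult_right hs_shift has_sum_infsum g0sum)
    then show ?thesis by (simp only: para)
  qed
  then have dsum: "d summable_on UNIV" and dval: "(\<Sum>\<^sub>\<infinity>m. d m) = 4 * E - 4 * (\<Sum>\<^sub>\<infinity>m. (norm (g 0 m))\<^sup>2)"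
    using summable_on_shift_int[of d "-1"] infsum_shift_int[of d "-1"]
    by (auto dest: has_sum_imp_summable infsumI)
  have "E \<le> \<kappa>\<^sup>2 * (\<Sum>\<^sub>\<infinity>m. (norm (g 0 m))\<^sup>2)"
    using bounded_preimages_energy[of \<kappa> g "2 * c"] \<kappa>1 gb gmean g0sum fsum unfolding g1 E_def by blast
  then have "(cos \<alpha>)\<^sup>2 * E \<le> (\<Sum>\<^sub>\<infinity>m. (norm (g 0 m))\<^sup>2)"
    using cpos by (simp add: \<kappa>_def field_simps)
  then have "(\<Sum>\<^sub>\<infinity>m. d m) \<le> 4 * (sin \<alpha>)\<^sup>2 * E"
    unfolding dval by (simp add: cos_squared_eq algebra_simps)
  then show "(\<lambda>m. (norm (F (m + 2, 0) - F (m, 0)))\<^sup>2) summable_on UNIV"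
    and "(\<Sum>\<^sub>\<infinity>m. (norm (F (m + 2, 0) - F (m, 0)))\<^sup>2) \<le> 4 * (sin \<alpha>)\<^sup>2 * (\<Sum>\<^sub>\<infinity>m. (norm (F (m, 0)))\<^sup>2)"
    using dsum by (simp_all add: d_def f_def E_def)
qed

section \<open>A cosine barrier on the gaps\<close>

text \<open>
  With \<open>A = cos t\<close> and \<open>B = cos (t + 2 * \<beta>)\<close> the coefficients are \<open>1 - B / A\<close> and \<open>1 - A / B\<close>, and
  the difference of the two sides is the square \<open>\<bar>sqrt (B / A) x - sqrt (A / B) y\<bar>\<^sup>2\<close>. In the
  form with tangents, the variable parts of two adjacent pairs inside one gap cancel.
\<close>

lemma cosine_barrier_pair:
  fixes x y :: "'a :: real_inner" and t \<beta> :: real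
  assumes "0 < cos t" "0 < cos (t + 2 * \<beta>)"
  shows "(norm x)\<^sup>2 * (1 - cos (2 * \<beta>) + sin (2 * \<beta>) * tan t)
       + (norm y)\<^sup>2 * (1 - cos (2 * \<beta>) - sin (2 * \<beta>) * tan (t + 2 * \<beta>)) \<le> (norm (y - x))\<^sup>2"
proof -
  define A where "A = cos t"
  define B where "B = cos (t + 2 * \<beta>)"
  have pos: "A > 0" "B > 0" using assms by (auto simp: A_def B_def)
  have l: "1 - cos (2 * \<beta>) + sin (2 * \<beta>) * tan t = 1 - B / A"
    using pos unfolding B_def cos_add by (simp add: A_def tan_def field_simps)
  have "A = cos ((t + 2 * \<beta>) - 2 * \<beta>)" by (simp add: A_def)
  also have "\<dots> = B * cos (2 * \<beta>) + sin (t + 2 * \<beta>) * sin (2 * \<beta>)"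
    by (simp only: cos_diff B_def)
  finally have A: "A = B * cos (2 * \<beta>) + sin (t + 2 * \<beta>) * sin (2 * \<beta>)" .
  have T: "tan (t + 2 * \<beta>) = sin (t + 2 * \<beta>) / B" by (simp add: tan_def B_def)
  have r: "1 - cos (2 * \<beta>) - sin (2 * \<beta>) * tan (t + 2 * \<beta>) = 1 - A / B"
    unfolding T using pos A by (simp add: field_simps)
  have "2 * (y \<bullet> x) \<le> B / A * (norm x)\<^sup>2 + 1 / (B / A) * (norm y)\<^sup>2"
    using pos by (intro inner_weighted_young) simp
  then have "2 * (y \<bullet> x) \<le> B / A * (norm x)\<^sup>2 + A / B * (norm y)\<^sup>2" by simp
  moreover have "(norm (y - x))\<^sup>2 = (norm y)\<^sup>2 + (norm x)\<^sup>2 - 2 * (y \<bullet> x)"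
    by (simp add: power2_norm_eq_inner algebra_simps inner_commute)
  ultimately show ?thesis unfolding l r by (simp add: algebra_simps)
qed

lemma summable_on_bounded_mult:
  fixes \<phi> b :: "'a \<Rightarrow> real"
  assumes "\<phi> summable_on A" "\<And>x. \<phi> x \<ge> 0" "\<And>x. \<bar>b x\<bar> \<le> C"
  shows "(\<lambda>x. \<phi> x * b x) summable_on A"
proof -
  have "(\<lambda>x. \<phi> x * C) summable_on A" using assms(1) by (rule summable_on_cmult_left)
  then have "(\<lambda>x. norm (\<phi> x * b x)) summable_on A"
    by (rule summable_on_comparison_test) (use assms in \<open>auto simp: abs_mult intro!: mult_left_mono\<close>)
  then show ?thesis by (rule abs_summable_summable)
qed

text \<open>
  In the application \<open>M m\<close> is the midpoint of the gap that contains both \<open>m\<close> and \<open>m + 2\<close>. Summing the pair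
  inequality, each point receives one tangent from the pair to its right and one from the pair to its
  left. They cancel at points outside \<open>\<Lambda>\<close>, where both pairs have the same midpoint, and are bounded by
  \<open>tan (\<beta> * D / 2)\<close> at the points of \<open>\<Lambda>\<close>.
\<close>

lemma cosine_barrier_energy:
  fixes f :: "int \<Rightarrow> complex" and M :: "int \<Rightarrow> real" and \<beta> D :: real
  assumes \<beta>: "0 < \<beta>" "\<beta> < pi / 2" "\<beta> * D < pi"
    and l2: "(\<lambda>m. (norm (f m))\<^sup>2) summable_on UNIV"
    and diff: "(\<lambda>m. (norm (f (m + 2) - f m))\<^sup>2) summable_on UNIV"
    and M: "\<And>m. \<bar>of_int m - M m\<bar> \<le> D / 2" "\<And>m. \<bar>of_int (m + 2) - M m\<bar> \<le> D / 2"
    and M_const: "\<And>m. m \<notin> \<Lambda> \<Longrightarrow> M m = M (m - 2)"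
  shows "4 * (sin \<beta>)\<^sup>2 * (\<Sum>\<^sub>\<infinity>m. (norm (f m))\<^sup>2)
    \<le> (\<Sum>\<^sub>\<infinity>m. (norm (f (m + 2) - f m))\<^sup>2) + 2 * sin (2 * \<beta>) * tan (\<beta> * D / 2) * (\<Sum>\<^sub>\<infinity>m\<in>\<Lambda>. (norm (f m))\<^sup>2)"
proof -
  define s where "s = sin (2 * \<beta>)"
  define c where "c = 1 - cos (2 * \<beta>)"
  define \<tau> where "\<tau> = tan (\<beta> * D / 2)"
  define \<phi> where "\<phi> = (\<lambda>m. (norm (f m))\<^sup>2)"
  define u where "u = (\<lambda>m. tan (\<beta> * (of_int m - M m)))"
  define v where "v = (\<lambda>m. tan (\<beta> * (of_int (m + 2) - M m)))"
  have s: "s > 0" unfolding s_def using \<beta> by (intro sin_gt_zero) auto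
  have angle: "\<bar>\<beta> * x\<bar> \<le> \<beta> * D / 2" if "\<bar>x\<bar> \<le> D / 2" for x
    using mult_left_mono[OF that, of \<beta>] \<beta> by (simp add: abs_mult)
  have cpos: "cos (\<beta> * x) > 0" if "\<bar>x\<bar> \<le> D / 2" for x
    using angle[OF that] \<beta> by (intro cos_gt_zero_pi) auto
  have tanb: "\<bar>tan (\<beta> * x)\<bar> \<le> \<tau>" if "\<bar>x\<bar> \<le> D / 2" for x
  proof -
    have "- (\<beta> * D / 2) \<le> \<beta> * x" "\<beta> * x \<le> \<beta> * D / 2" "\<beta> * D / 2 < pi / 2"
      using angle[OF that] \<beta>(3) by linarith+
    then have "tan (\<beta> * x) \<le> tan (\<beta> * D / 2)" "tan (- (\<beta> * D / 2)) \<le> tan (\<beta> * x)"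
      by (intro tan_mono_le; linarith)+
    then show ?thesis by (simp add: \<tau>_def abs_le_iff)
  qed
  have ub: "\<bar>u m\<bar> \<le> \<tau>" "\<bar>v m\<bar> \<le> \<tau>" for m
    unfolding u_def v_def by (rule tanb; rule M)+
  have \<phi>0: "\<phi> m \<ge> 0" for m by (simp add: \<phi>_def)
  have \<phi>s: "\<phi> summable_on UNIV" using l2 by (simp add: \<phi>_def)
  have pair: "\<phi> m * (c + s * u m) + \<phi> (m + 2) * (c - s * v m) \<le> (norm (f (m + 2) - f m))\<^sup>2" for m
  proof -
    have t: "\<beta> * (of_int (m + 2) - M m) = \<beta> * (of_int m - M m) + 2 * \<beta>" by (simp add: algebra_simps)
    show ?thesis
      using cosine_barrier_pair[of "\<beta> * (of_int m - M m)" \<beta> "f m" "f (m + 2)"] cpos[OF M(1)[of m]] cpos[OF M(2)[of m]]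
      by (simp only: t \<phi>_def c_def s_def u_def v_def)
  qed
  have cb: "\<bar>c + s * x\<bar> \<le> \<bar>c\<bar> + s * \<tau>" "\<bar>c - s * x\<bar> \<le> \<bar>c\<bar> + s * \<tau>" if "\<bar>x\<bar> \<le> \<tau>" for x
  proof -
    have "\<bar>s * x\<bar> \<le> s * \<tau>" using that s by (simp add: abs_mult)
    then show "\<bar>c + s * x\<bar> \<le> \<bar>c\<bar> + s * \<tau>" "\<bar>c - s * x\<bar> \<le> \<bar>c\<bar> + s * \<tau>" by linarith+
  qed
  define U where "U = (\<lambda>m. \<phi> m * (c + s * u m))"
  define V where "V = (\<lambda>m. \<phi> m * (c - s * v (m - 2)))"
  have Us: "U summable_on UNIV" and Vs: "V summable_on UNIV"
    unfolding U_def V_def by (rule summable_on_bounded_mult[OF \<phi>s \<phi>0 cb(1)[OF ub(1)]],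
        rule summable_on_bounded_mult[OF \<phi>s \<phi>0 cb(2)[OF ub(2)]])
  have Vs2: "(\<lambda>m. V (m + 2)) summable_on UNIV" using Vs by (subst summable_on_shift_int)
  define I where "I = (\<lambda>m. if m \<in> \<Lambda> then \<phi> m else 0)"
  have Isum: "I summable_on UNIV" and Ival: "(\<Sum>\<^sub>\<infinity>m. I m) = (\<Sum>\<^sub>\<infinity>m\<in>\<Lambda>. \<phi> m)"
  proof -
    have "\<phi> summable_on \<Lambda>" using \<phi>s by (rule summable_on_subset) simp
    moreover have "I summable_on UNIV \<longleftrightarrow> \<phi> summable_on \<Lambda>"
      by (rule summable_on_cong_neutral) (auto simp: I_def)
    ultimately show "I summable_on UNIV" by simp
    show "(\<Sum>\<^sub>\<infinity>m. I m) = (\<Sum>\<^sub>\<infinity>m\<in>\<Lambda>. \<phi> m)"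
      by (rule infsum_cong_neutral) (auto simp: I_def)
  qed
  have low: "2 * c * \<phi> m + - (2 * s * \<tau>) * I m \<le> U m + V m" for m
  proof (cases "m \<in> \<Lambda>")
    case True
    have "- (2 * \<tau>) \<le> u m - v (m - 2)" using ub(1)[of m] ub(2)[of "m - 2"] by linarith
    then have "s * - (2 * \<tau>) \<le> s * (u m - v (m - 2))" using s by (intro mult_left_mono) auto
    then have "\<phi> m * (s * - (2 * \<tau>)) \<le> \<phi> m * (s * (u m - v (m - 2)))" by (rule mult_left_mono[OF _ \<phi>0])
    then show ?thesis using True by (simp add: U_def V_def I_def algebra_simps)
  next
    case False
    then have "v (m - 2) = u m" using M_const[OF False] by (simp add: u_def v_def)
    then show ?thesis using False by (simp add: U_def V_def I_def algebra_simps)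
  qed
  have "((\<lambda>m. 2 * c * \<phi> m + - (2 * s * \<tau>) * I m) has_sum
      (2 * c * (\<Sum>\<^sub>\<infinity>m. \<phi> m) + - (2 * s * \<tau>) * (\<Sum>\<^sub>\<infinity>m. I m))) UNIV"
    by (intro has_sum_add has_sum_cmult_right has_sum_infsum \<phi>s Isum)
  then have "2 * c * (\<Sum>\<^sub>\<infinity>m. \<phi> m) + - (2 * s * \<tau>) * (\<Sum>\<^sub>\<infinity>m. I m) \<le> (\<Sum>\<^sub>\<infinity>m. U m) + (\<Sum>\<^sub>\<infinity>m. V m)"
    by (rule has_sum_mono[OF _ has_sum_add[OF has_sum_infsum[OF Us] has_sum_infsum[OF Vs]] low])
  also have "\<dots> = (\<Sum>\<^sub>\<infinity>m. U m) + (\<Sum>\<^sub>\<infinity>m. V (m + 2))" by (simp only: infsum_shift_int)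
  also have "\<dots> = (\<Sum>\<^sub>\<infinity>m. U m + V (m + 2))" by (rule infsum_add[OF Us Vs2, symmetric])
  also have "\<dots> \<le> (\<Sum>\<^sub>\<infinity>m. (norm (f (m + 2) - f m))\<^sup>2)"
    by (rule infsum_mono[OF summable_on_add[OF Us Vs2] diff]) (use pair in \<open>simp add: U_def V_def\<close>)
  finally have "2 * c * (\<Sum>\<^sub>\<infinity>m. \<phi> m) \<le> (\<Sum>\<^sub>\<infinity>m. (norm (f (m + 2) - f m))\<^sup>2) + 2 * s * \<tau> * (\<Sum>\<^sub>\<infinity>m\<in>\<Lambda>. \<phi> m)"
    by (simp add: Ival)
  moreover have "2 * c = 4 * (sin \<beta>)\<^sup>2" by (simp add: c_def cos_double_sin)
  ultimately show ?thesis by (simp only: \<phi>_def s_def \<tau>_def)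
qed

section \<open>Gaps within a parity class\<close>

lemma strict_mono_int_bracket:
  fixes p :: "int \<Rightarrow> int"
  assumes "strict_mono p"
  shows "\<exists>!k. p k \<le> m \<and> m < p (k + 1)"
proof (rule ex_ex1I)
  have grow: "p i + int n \<le> p (i + int n)" for i n
  proof (induction n)
    case (Suc n)
    have "p (i + int n) < p (i + int (Suc n))" by (rule strict_monoD[OF assms]) simp
    then show ?case using Suc by simp
  qed simp
  define N where "N = nat \<bar>m - p 0\<bar> + 1"
  have low: "p (- int N) \<le> m" using grow[of "- int N" N] by (simp add: N_def)
  have high: "m < p (int N)" using grow[of 0 N] by (simp add: N_def)
  \<comment> \<open>Walking up from an index whose value is at most \<open>m\<close>, the first value above \<open>m\<close> ends the gap.\<close>
  have "m < p (- int N + int n) \<Longrightarrow> \<exists>k. p k \<le> m \<and> m < p (k + 1)" for n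
  proof (induction n)
    case (Suc n)
    then show ?case
    proof (cases "m < p (- int N + int n)")
      case False
      then show ?thesis using Suc.prems by (intro exI[of _ "- int N + int n"]) (simp add: algebra_simps)
    qed simp
  qed (use low in simp)
  from this[of "2 * N"] high show "\<exists>k. p k \<le> m \<and> m < p (k + 1)" by simp
next
  fix k l
  have mono: "p i \<le> p j" if "i \<le> j" for i j
    using assms that by (simp add: strict_mono_less_eq)
  assume "p k \<le> m \<and> m < p (k + 1)" "p l \<le> m \<and> m < p (l + 1)"
  then show "k = l" using mono[of "k + 1" l] mono[of "l + 1" k] by linarith
qed

text \<open>
  Restricted to one parity class, a gap that contains \<open>m\<close> in its half-open form also contains \<open>m + 2\<close>
  in its closed form, and a point outside \<open>\<Lambda>\<close> lies in the same gap as its predecessor \<open>m - 2\<close>.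
\<close>

lemma gap_midpoints:
  fixes p :: "int \<Rightarrow> int" and D :: real and r :: int
  assumes p: "strict_mono p" "\<Lambda> \<inter> {m. m mod 2 = r} = range p"
    and gap: "\<And>k. of_int (p (k + 1) - p k) \<le> D"
  shows "\<exists>M :: int \<Rightarrow> real. \<forall>m. m mod 2 = r \<longrightarrow>
    \<bar>of_int m - M m\<bar> \<le> D / 2 \<and> \<bar>of_int (m + 2) - M m\<bar> \<le> D / 2 \<and> (m \<notin> \<Lambda> \<longrightarrow> M m = M (m - 2))"
proof -
  define k where "k = (\<lambda>m. THE k. p k \<le> m \<and> m < p (k + 1))"
  have k: "p (k m) \<le> m" "m < p (k m + 1)" for m
    using theI'[OF strict_mono_int_bracket[OF p(1), of m]] by (auto simp: k_def)
  have k_unique: "k m = j" if "p j \<le> m" "m < p (j + 1)" for m j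
    unfolding k_def by (rule the1_equality[OF strict_mono_int_bracket[OF p(1)]]) (use that in simp)
  have par: "p j mod 2 = r" for j using p(2) by blast
  define M where "M = (\<lambda>m. (real_of_int (p (k m)) + real_of_int (p (k m + 1))) / 2)"
  have "\<bar>of_int m - M m\<bar> \<le> D / 2 \<and> \<bar>of_int (m + 2) - M m\<bar> \<le> D / 2 \<and> (m \<notin> \<Lambda> \<longrightarrow> M m = M (m - 2))" if m: "m mod 2 = r" for m
  proof (intro conjI impI)
    have up: "m + 2 \<le> p (k m + 1)" using k(2)[of m] m par[of "k m + 1"] by presburger
    have real: "real_of_int (p (k m)) \<le> m" "real_of_int (m + 2) \<le> p (k m + 1)"
      using k(1)[of m] up by (simp_all only: of_int_le_iff)
    then show "\<bar>of_int m - M m\<bar> \<le> D / 2" "\<bar>of_int (m + 2) - M m\<bar> \<le> D / 2"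
      using gap[of "k m"] unfolding M_def by (simp_all add: abs_le_iff field_simps)
    assume "m \<notin> \<Lambda>"
    then have "p (k m) < m" using p(2) k(1)[of m] by (metis IntE le_less rangeI)
    then have "p (k m) \<le> m - 2" using m par[of "k m"] by presburger
    then have "k (m - 2) = k m" using k(2)[of m] by (intro k_unique) auto
    then show "M m = M (m - 2)" by (simp add: M_def)
  qed
  then show ?thesis by (intro exI[of _ M] allI impI)
qed

section \<open>The sampling inequality\<close>

theorem theorem1p7:
  fixes \<alpha> :: real and \<Lambda> :: "int set" and p q :: "int \<Rightarrow> int"
  assumes "0 < \<alpha>" and "\<alpha> < pi / 2"
    and "strict_mono p" and "\<Lambda> \<inter> {m. even m} = range p"
    and "strict_mono q" and "\<Lambda> \<inter> {m. odd m} = range q"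
    and "max (sup_gap p) (sup_gap q) < ereal (pi / \<alpha>)"
  shows "\<exists>c>0. \<forall>F\<in>PW \<alpha>.
           c * (PW_norm F)\<^sup>2 \<le> (\<Sum>\<^sub>\<infinity>l\<in>\<Lambda>. (norm (F (l, 0)))\<^sup>2) \<and>
           (\<Sum>\<^sub>\<infinity>l\<in>\<Lambda>. (norm (F (l, 0)))\<^sup>2) \<le> (PW_norm F)\<^sup>2"
proof -
  obtain D where D: "max (sup_gap p) (sup_gap q) < ereal D" "ereal D < ereal (pi / \<alpha>)"
    using ereal_dense2[OF assms(7)] by blast
  have gap: "of_int (s (k + 1) - s k) \<le> D" if "sup_gap s < ereal D" for s k
  proof -
    have "ereal (of_int (s (k + 1) - s k)) \<le> sup_gap s"
      unfolding sup_gap_def by (rule SUP_upper) simp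
    then show ?thesis using that by (metis ereal_less_eq(3) less_imp_le order_trans)
  qed
  have gp: "of_int (p (k + 1) - p k) \<le> D" and gq: "of_int (q (k + 1) - q k) \<le> D" for k
    using gap D(1) by (simp_all only: max_less_iff_conj)
  have "0 < D"
  proof -
    have "p 0 < p (0 + 1)" by (rule strict_monoD[OF assms(3)]) simp
    then show ?thesis using gp[of 0] by linarith
  qed
  then have "\<alpha> < min (pi / 2) (pi / D)" using D(2) assms(1,2) by (simp add: field_simps)
  then obtain \<beta> where "\<alpha> < \<beta>" "\<beta> < min (pi / 2) (pi / D)" using dense by blast
  then have \<beta>: "\<alpha> < \<beta>" "0 < \<beta>" "\<beta> < pi / 2" "\<beta> * D < pi"
    using assms(1) \<open>0 < D\<close> by (auto simp: field_simps)
  have even_part: "\<Lambda> \<inter> {m. m mod 2 = 0} = range p" and odd_part: "\<Lambda> \<inter> {m. m mod 2 = 1} = range q"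
    using assms(4,6) by (simp_all only: even_iff_mod_2_eq_zero not_mod_2_eq_0_eq_1)
  from gap_midpoints[OF assms(3) even_part gp] obtain Mp :: "int \<Rightarrow> real"
    where Mp: "\<forall>m. m mod 2 = 0 \<longrightarrow> \<bar>of_int m - Mp m\<bar> \<le> D / 2 \<and>
      \<bar>of_int (m + 2) - Mp m\<bar> \<le> D / 2 \<and> (m \<notin> \<Lambda> \<longrightarrow> Mp m = Mp (m - 2))" ..
  from gap_midpoints[OF assms(5) odd_part gq] obtain Mq :: "int \<Rightarrow> real"
    where Mq: "\<forall>m. m mod 2 = 1 \<longrightarrow> \<bar>of_int m - Mq m\<bar> \<le> D / 2 \<and>
      \<bar>of_int (m + 2) - Mq m\<bar> \<le> D / 2 \<and> (m \<notin> \<Lambda> \<longrightarrow> Mq m = Mq (m - 2))" ..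
  define M where "M = (\<lambda>m. if even m then Mp m else Mq m)"
  have M: "\<bar>of_int m - M m\<bar> \<le> D / 2" "\<bar>of_int (m + 2) - M m\<bar> \<le> D / 2" "m \<notin> \<Lambda> \<Longrightarrow> M m = M (m - 2)" for m
    using Mp[rule_format, of m] Mq[rule_format, of m] unfolding M_def
    by (cases "even m"; simp add: even_iff_mod_2_eq_zero odd_iff_mod_2_eq_one)+
  define C where "C = 2 * sin (2 * \<beta>) * tan (\<beta> * D / 2)"
  have C: "C > 0"
    unfolding C_def using \<beta> \<open>0 < D\<close> by (intro mult_pos_pos sin_gt_zero tan_gt_zero) auto
  define \<delta> where "\<delta> = 4 * (sin \<beta>)\<^sup>2 - 4 * (sin \<alpha>)\<^sup>2"
  have \<delta>: "\<delta> > 0"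
  proof -
    have "sin \<alpha> < sin \<beta>" using \<beta> assms(1,2) by (intro sin_monotone_2pi) auto
    moreover have "0 < sin \<alpha>" using assms(1,2) by (intro sin_gt_zero) auto
    ultimately have "(sin \<alpha>)\<^sup>2 < (sin \<beta>)\<^sup>2" by (intro power_strict_mono) auto
    then show ?thesis by (simp add: \<delta>_def)
  qed
  have "\<delta> / C * (PW_norm F)\<^sup>2 \<le> (\<Sum>\<^sub>\<infinity>l\<in>\<Lambda>. (norm (F (l, 0)))\<^sup>2) \<and>
      (\<Sum>\<^sub>\<infinity>l\<in>\<Lambda>. (norm (F (l, 0)))\<^sup>2) \<le> (PW_norm F)\<^sup>2" if F: "F \<in> PW \<alpha>" for F
  proof
    define E where "E = (\<Sum>\<^sub>\<infinity>m. (norm (F (m, 0)))\<^sup>2)"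
    have l2: "(\<lambda>m. (norm (F (m, 0)))\<^sup>2) summable_on UNIV" using F by (simp add: PW_def)
    have norm: "(PW_norm F)\<^sup>2 = E"
      unfolding PW_norm_def E_def by (intro real_sqrt_pow2 infsum_nonneg) simp
    have "4 * (sin \<beta>)\<^sup>2 * E \<le> (\<Sum>\<^sub>\<infinity>m. (norm (F (m + 2, 0) - F (m, 0)))\<^sup>2) + C * (\<Sum>\<^sub>\<infinity>l\<in>\<Lambda>. (norm (F (l, 0)))\<^sup>2)"
      unfolding E_def C_def
      by (rule cosine_barrier_energy[OF \<beta>(2-4) l2 PW_double_difference(1)[OF assms(1,2) F] M])
    also have "(\<Sum>\<^sub>\<infinity>m. (norm (F (m + 2, 0) - F (m, 0)))\<^sup>2) \<le> 4 * (sin \<alpha>)\<^sup>2 * E"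
      unfolding E_def by (rule PW_double_difference(2)[OF assms(1,2) F])
    finally have "\<delta> * E \<le> C * (\<Sum>\<^sub>\<infinity>l\<in>\<Lambda>. (norm (F (l, 0)))\<^sup>2)"
      by (simp add: \<delta>_def algebra_simps)
    then show "\<delta> / C * (PW_norm F)\<^sup>2 \<le> (\<Sum>\<^sub>\<infinity>l\<in>\<Lambda>. (norm (F (l, 0)))\<^sup>2)"
      using C by (simp add: norm field_simps)
    show "(\<Sum>\<^sub>\<infinity>l\<in>\<Lambda>. (norm (F (l, 0)))\<^sup>2) \<le> (PW_norm F)\<^sup>2"
      unfolding norm E_def using l2 by (intro infsum_mono_neutral) (auto intro: summable_on_subset)
  qed
  then show ?thesis using C \<delta> by (intro exI[of _ "\<delta> / C"]) auto
qed

end
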